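(* Let $G$ be a 2-connected graph and $T^{start},T^{goal}\in\mathcal{T}(G)$. For some $k\in\mathbb{Z}_{\ge 0}$, there exists a sequence $(T^0=T^{start},T^1,\dots,T^k=T^{goal})\in\mathcal{T}(G)^{k+1}$ such that for every $i\in\{1,\dots,k\}$ we have $|T^{i-1}\setminus T^{i}|=|T^{i}\setminus T^{i-1}|=1$ and the unique element of $T^{i-1}\setminus T^{i}$ is a leaf edge of $T^{i-1}$.
   Context: All graphs are finite, connected and undirected; parallel edges are allowed, loops are not. A graph is 2-connected if it has no cut vertices. $\mathcal{T}(G)$ is the set of spanning trees of $G$, viewed as subsets of $E(G)$. A leaf vertex of a spanning tree $T$ is a vertex incident to exactly one edge of $T$; a leaf edge of $T$ is an edge of $T$ incident to a leaf vertex of $T$. *)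

theory Defs
  imports Main
begin

text \<open>
  Undirected multigraphs: edges are abstract objects with a set of end vertices, so parallel
  edges are distinct edges with the same ends. The digraphs of the AFP entry Graph Theory are not
  used, as their notion of a forest only excludes directed cycles.
\<close>

record ('v, 'e) multigraph =
  verts :: "'v set"
  edges :: "'e set"
  ends :: "'e \<Rightarrow> 'v set"

definition reachable :: "('v, 'e) multigraph \<Rightarrow> 'v \<Rightarrow> 'v \<Rightarrow> bool" where
  "reachable G u w \<longleftrightarrow> (u, w) \<in> {(x, y). \<exists>e\<in>edges G. ends G e = {x, y}}\<^sup>*"

definition connected :: "('v, 'e) multigraph \<Rightarrow> bool" where
  "connected G \<longleftrightarrow> verts G \<noteq> {} \<and> (\<forall>u\<in>verts G. \<forall>w\<in>verts G. reachable G u w)"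

text \<open>Two distinct ends per edge means that there are no loops.\<close>

locale graph =
  fixes G :: "('v, 'e) multigraph"
  assumes finite_verts: "finite (verts G)"
    and finite_edges: "finite (edges G)"
    and ends_subset: "e \<in> edges G \<Longrightarrow> ends G e \<subseteq> verts G"
    and card_ends: "e \<in> edges G \<Longrightarrow> card (ends G e) = 2"
    and connected: "connected G"

definition del_vertex :: "('v, 'e) multigraph \<Rightarrow> 'v \<Rightarrow> ('v, 'e) multigraph" where
  "del_vertex G v =
     \<lparr>verts = verts G - {v}, edges = {e \<in> edges G. v \<notin> ends G e}, ends = ends G\<rparr>"

text \<open>
  For connected graphs. Deleting the only vertex of a one-vertex graph leaves the empty graph,
  which does not make that vertex a cut vertex.
\<close>

definition cut_vertex :: "('v, 'e) multigraph \<Rightarrow> 'v \<Rightarrow> bool" where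
  "cut_vertex G v \<longleftrightarrow> v \<in> verts G \<and>
     (\<exists>u\<in>verts (del_vertex G v). \<exists>w\<in>verts (del_vertex G v). \<not> reachable (del_vertex G v) u w)"

definition two_connected :: "('v, 'e) multigraph \<Rightarrow> bool" where
  "two_connected G \<longleftrightarrow> \<not> (\<exists>v. cut_vertex G v)"

text \<open>
  A cycle with vertices \<open>vs\<close> and edges \<open>es\<close>, where \<open>es ! i\<close> joins \<open>vs ! i\<close> to its cyclic successor.
  Two parallel edges form a cycle of length 2.
\<close>

definition is_cycle :: "('v, 'e) multigraph \<Rightarrow> 'v list \<Rightarrow> 'e list \<Rightarrow> bool" where
  "is_cycle G vs es \<longleftrightarrow> vs \<noteq> [] \<and> length es = length vs \<and> distinct vs \<and> distinct es \<and>
     set vs \<subseteq> verts G \<and> set es \<subseteq> edges G \<and>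
     (\<forall>i<length vs. ends G (es ! i) = {vs ! i, vs ! (Suc i mod length vs)})"

definition tree :: "('v, 'e) multigraph \<Rightarrow> bool" where
  "tree G \<longleftrightarrow> connected G \<and> \<not> (\<exists>vs es. is_cycle G vs es)"

definition spanning_trees :: "('v, 'e) multigraph \<Rightarrow> 'e set set" where
  "spanning_trees G = {T. T \<subseteq> edges G \<and> tree (G\<lparr>edges := T\<rparr>)}"

definition leaf_vertex :: "('v, 'e) multigraph \<Rightarrow> 'e set \<Rightarrow> 'v \<Rightarrow> bool" where
  "leaf_vertex G T v \<longleftrightarrow> v \<in> verts G \<and> card {e \<in> T. v \<in> ends G e} = 1"

definition leaf_edge :: "('v, 'e) multigraph \<Rightarrow> 'e set \<Rightarrow> 'e \<Rightarrow> bool" where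
  "leaf_edge G T e \<longleftrightarrow> e \<in> T \<and> (\<exists>v\<in>ends G e. leaf_vertex G T v)"

end

theory Submission
  imports Defs
begin

text \<open>
  Root all spanning trees at a vertex \<open>r\<close>. Any non-root vertex \<open>y\<close> of a tree can be turned into a
  leaf by reattaching only proper descendants of \<open>y\<close>: if \<open>y\<close> has proper descendants, then, \<open>y\<close> not
  being a cut vertex, an edge joins some proper descendant \<open>u\<close> to a non-descendant \<open>w\<close>; make \<open>u\<close> a
  leaf recursively, reattach it to \<open>w\<close>, and note that the set of descendants of \<open>y\<close> has shrunk.
  Therefore a subtree through \<open>r\<close> shared with the goal tree can be enlarged one vertex at a time:
  pick an edge of the goal tree from the subtree to a vertex \<open>y\<close> outside it, turn \<open>y\<close> into a leaf
  (the subtree contains no descendant of \<open>y\<close>), and reattach \<open>y\<close> along that edge.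
\<close>

text \<open>Encoded as a relation so that the sequences sought are exactly the chains of its
  relational powers.\<close>

definition exchange :: "('v, 'e) multigraph \<Rightarrow> ('e set \<times> 'e set) set" where
  "exchange G = {(T, T'). T \<in> spanning_trees G \<and> T' \<in> spanning_trees G \<and>
     card (T - T') = 1 \<and> card (T' - T) = 1 \<and> (\<forall>e\<in>T - T'. leaf_edge G T e)}"

section \<open>Walks, paths and chords\<close>

definition adj :: "('v, 'e) multigraph \<Rightarrow> ('v \<times> 'v) set" where
  "adj G = {(x, y). \<exists>e\<in>edges G. ends G e = {x, y}}"

lemma reachable_adj: "reachable G u w \<longleftrightarrow> (u, w) \<in> (adj G)\<^sup>*"
  by (simp add: reachable_def adj_def)

lemma sym_adj: "sym (adj G)"
  by (auto simp: adj_def sym_def insert_commute)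

lemma rtrancl_leaves_set:
  assumes "(a, b) \<in> R\<^sup>*" "a \<in> A" "b \<notin> A"
  shows "\<exists>x y. (x, y) \<in> R \<and> x \<in> A \<and> y \<notin> A"
  using assms by (induction rule: rtrancl_induct) blast+

lemma rtrancl_closed:
  assumes "(a, b) \<in> R\<^sup>*" "a \<in> A" "\<And>x y. (x, y) \<in> R \<Longrightarrow> x \<in> A \<Longrightarrow> y \<in> A"
  shows "b \<in> A"
  using assms rtrancl_leaves_set[of a b R A] by blast

text \<open>A walk is built from its end. If the vertex to be prepended already occurs, everything
  before that occurrence is dropped instead, which keeps the vertices distinct.\<close>

lemma adj_rtrancl_path:
  assumes "(a, b) \<in> (adj G)\<^sup>*"
  shows "\<exists>vs es. vs \<noteq> [] \<and> hd vs = a \<and> last vs = b \<and> distinct vs \<and> length vs = Suc (length es) \<and>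
    set es \<subseteq> edges G \<and> (\<forall>i<length es. ends G (es ! i) = {vs ! i, vs ! Suc i})"
  using assms
proof (induction rule: converse_rtrancl_induct)
  case base
  show ?case by (rule exI[of _ "[b]"], rule exI[of _ "[]"]) simp
next
  case (step a a')
  then obtain vs es where p: "vs \<noteq> []" "hd vs = a'" "last vs = b" "distinct vs"
    "length vs = Suc (length es)" "set es \<subseteq> edges G"
    "\<And>i. i < length es \<Longrightarrow> ends G (es ! i) = {vs ! i, vs ! Suc i}" by blast
  from step obtain e where e: "e \<in> edges G" "ends G e = {a, a'}" by (auto simp: adj_def)
  show ?case
  proof (cases "a \<in> set vs")
    case True
    then obtain n where n: "n < length vs" "vs ! n = a" by (auto simp: in_set_conv_nth)
    show ?thesis
      using n p set_drop_subset[of n es]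
      by (intro exI[of _ "drop n vs"] exI[of _ "drop n es"]) (auto simp: hd_drop_conv_nth)
  next
    case False
    have "ends G ((e # es) ! i) = {(a # vs) ! i, (a # vs) ! Suc i}" if "i < length (e # es)" for i
      using that e p by (cases i) (auto simp: hd_conv_nth)
    then show ?thesis
      using p e False by (intro exI[of _ "a # vs"] exI[of _ "e # es"]) auto
  qed
qed

text \<open>A path inside \<open>F\<close> between the ends of \<open>e\<close> is closed up by
  \<open>e\<close>, which is not one of its edges.\<close>

lemma cycle_of_chord:
  assumes "F \<subseteq> T" "e \<in> T - F" "ends G e = {a, b}" "\<And>e. e \<in> T \<Longrightarrow> ends G e \<subseteq> verts G"
    and "(a, b) \<in> (adj (G\<lparr>edges := F\<rparr>))\<^sup>*"
  shows "\<exists>vs es. is_cycle (G\<lparr>edges := T\<rparr>) vs es"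
proof -
  obtain vs es where p: "vs \<noteq> []" "hd vs = a" "last vs = b" "distinct vs"
    "length vs = Suc (length es)" "set es \<subseteq> F"
    "\<And>i. i < length es \<Longrightarrow> ends G (es ! i) = {vs ! i, vs ! Suc i}"
    using adj_rtrancl_path[OF assms(5)] by auto
  have "distinct es"
    unfolding distinct_conv_nth
  proof (intro allI impI notI)
    fix i j assume ij: "i < length es" "j < length es" "i \<noteq> j" "es ! i = es ! j"
    then have "{vs ! i, vs ! Suc i} = {vs ! j, vs ! Suc j}" using p(7) by metis
    \<comment> \<open>As the vertices are distinct, equal pairs at \<open>i \<noteq> j\<close> would
      need both \<open>i = Suc j\<close> and \<open>j = Suc i\<close>.\<close>
    then show False using ij p(4,5) by (auto simp: doubleton_eq_iff nth_eq_iff_index_eq)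
  qed
  moreover have c: "ends G ((es @ [e]) ! i) = {vs ! i, vs ! (Suc i mod length vs)}"
    if "i < length vs" for i
  proof (cases "i < length es")
    case True
    then show ?thesis using p by (simp add: nth_append)
  next
    case False
    \<comment> \<open>Here \<open>Suc i mod length vs\<close> wraps to 0, and \<open>e\<close> joins
      the last vertex \<open>b\<close> to the first vertex \<open>a\<close>.\<close>
    then have "i = length es" using that p by simp
    then show ?thesis using p assms(3)
      by (auto simp: nth_append hd_conv_nth last_conv_nth)
  qed
  moreover have "set vs \<subseteq> verts G"
  proof
    fix v assume "v \<in> set vs"
    then obtain i where i: "i < length vs" "vs ! i = v" by (auto simp: in_set_conv_nth)
    then have "v \<in> ends G ((es @ [e]) ! i)" using c by simp
    moreover have "(es @ [e]) ! i \<in> set (es @ [e])" using i p(5) by (intro nth_mem) simp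
    ultimately show "v \<in> verts G" using assms(1,2,4) p(6) by fastforce
  qed
  ultimately have "is_cycle (G\<lparr>edges := T\<rparr>) vs (es @ [e])"
    using p assms(1,2) by (auto simp: is_cycle_def)
  then show ?thesis by blast
qed

text \<open>
  A rooted spanning tree is encoded by a function \<open>f\<close> that maps each non-root vertex to the pair of
  its parent edge and its parent. Values at the root are irrelevant. The function \<open>d\<close> below,
  decreasing along parents, rules out cycles.
\<close>

locale rooted_graph = graph +
  fixes r
  assumes root: "r \<in> verts G"
begin

section \<open>Parent functions and leaf moves\<close>

definition rooted :: "('a \<Rightarrow> 'b \<times> 'a) \<Rightarrow> bool" where
  "rooted f \<longleftrightarrow>
     (\<forall>v\<in>verts G - {r}. fst (f v) \<in> edges G \<and> ends G (fst (f v)) = {v, snd (f v)}) \<and>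
     (\<exists>d :: 'a \<Rightarrow> nat. \<forall>v\<in>verts G - {r}. d (snd (f v)) < d v)"

definition tree_edges :: "('a \<Rightarrow> 'b \<times> 'a) \<Rightarrow> 'b set" where
  "tree_edges f = (\<lambda>v. fst (f v)) ` (verts G - {r})"

definition parent_rel :: "('a \<Rightarrow> 'b \<times> 'a) \<Rightarrow> ('a \<times> 'a) set" where
  "parent_rel f = {(v, snd (f v)) | v. v \<in> verts G - {r}}"

definition desc :: "('a \<Rightarrow> 'b \<times> 'a) \<Rightarrow> 'a \<Rightarrow> 'a set" where
  "desc f y = {v \<in> verts G. (v, y) \<in> (parent_rel f)\<^sup>*}"

text \<open>The root is excluded even if it has degree one, since it has no parent edge to
  exchange.\<close>

definition is_leaf :: "('a \<Rightarrow> 'b \<times> 'a) \<Rightarrow> 'a \<Rightarrow> bool" where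
  "is_leaf f y \<longleftrightarrow> y \<in> verts G - {r} \<and> (\<forall>v\<in>verts G - {r}. snd (f v) \<noteq> y)"

text \<open>The set \<open>D\<close> bounds which vertices may be reattached, so all other parents
  are known to be unchanged. A step may also reinsert the old edge.\<close>

inductive moves :: "'a set \<Rightarrow> ('a \<Rightarrow> 'b \<times> 'a) \<Rightarrow> ('a \<Rightarrow> 'b \<times> 'a) \<Rightarrow> bool" for D f where
  refl: "moves D f f"
| step: "moves D f g \<Longrightarrow> y \<in> D \<Longrightarrow> is_leaf g y \<Longrightarrow> e \<in> edges G \<Longrightarrow> ends G e = {y, w} \<Longrightarrow>
    moves D f (g(y := (e, w)))"

lemma rooted_edge:
  assumes "rooted f" "v \<in> verts G" "v \<noteq> r"
  shows "fst (f v) \<in> edges G" "ends G (fst (f v)) = {v, snd (f v)}"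
    "snd (f v) \<in> verts G" "snd (f v) \<noteq> v"
proof -
  show a: "fst (f v) \<in> edges G" "ends G (fst (f v)) = {v, snd (f v)}"
    using assms by (auto simp: rooted_def)
  show "snd (f v) \<in> verts G" using ends_subset[OF a(1)] a(2) by auto
  show "snd (f v) \<noteq> v" using card_ends[OF a(1)] a(2) by auto
qed

lemma rooted_reattach:
  assumes "rooted f" "is_leaf f y" "e \<in> edges G" "ends G e = {y, w}"
  shows "rooted (f(y := (e, w)))"
proof -
  obtain d :: "'a \<Rightarrow> nat" where d: "\<And>v. v \<in> verts G - {r} \<Longrightarrow> d (snd (f v)) < d v"
    using assms(1) by (auto simp: rooted_def)
  have "w \<noteq> y" using card_ends[OF assms(3)] assms(4) by auto
  \<comment> \<open>The leaf is placed one level below its new parent. No vertex has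
    \<open>y\<close> as its parent, so all other inequalities survive.\<close>
  then have "\<forall>v\<in>verts G - {r}. (d(y := Suc (d w))) (snd ((f(y := (e, w))) v)) < (d(y := Suc (d w))) v"
    using d assms(2) by (auto simp: is_leaf_def)
  then show ?thesis using assms unfolding rooted_def by (intro conjI exI) auto
qed

lemma moves_rooted: "moves D f g \<Longrightarrow> rooted f \<Longrightarrow> rooted g"
  by (induction rule: moves.induct) (auto intro: rooted_reattach)

lemma moves_unchanged: "moves D f g \<Longrightarrow> v \<notin> D \<Longrightarrow> g v = f v"
  by (induction rule: moves.induct) auto

lemma moves_mono: "moves D f g \<Longrightarrow> D \<subseteq> D' \<Longrightarrow> moves D' f g"
  by (induction rule: moves.induct) (auto intro: moves.intros)

lemma moves_trans:
  assumes "moves D g h" "moves D f g"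
  shows "moves D f h"
  using assms by (induction rule: moves.induct) (auto intro: moves.intros)

section \<open>Descendant sets\<close>

lemma desc_self: "y \<in> verts G \<Longrightarrow> y \<in> desc f y"
  by (simp add: desc_def)

lemma root_notin_desc:
  assumes "y \<noteq> r"
  shows "r \<notin> desc f y"
  using assms by (auto simp: desc_def parent_rel_def elim: converse_rtranclE)

lemma parent_in_desc:
  assumes "v \<in> desc f y" "v \<noteq> y" "rooted f"
  shows "v \<noteq> r" "snd (f v) \<in> desc f y"
proof -
  obtain z where z: "(v, z) \<in> parent_rel f" "(z, y) \<in> (parent_rel f)\<^sup>*"
    using assms(1,2) by (auto simp: desc_def elim: converse_rtranclE)
  then show "v \<noteq> r" by (auto simp: parent_rel_def)
  with z show "snd (f v) \<in> desc f y"
    using rooted_edge(3)[OF assms(3)] by (auto simp: desc_def parent_rel_def)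
qed

lemma in_desc_of_parent:
  assumes "v \<in> verts G" "v \<noteq> r" "snd (f v) \<in> desc f y"
  shows "v \<in> desc f y"
proof -
  have "(v, snd (f v)) \<in> parent_rel f" using assms by (auto simp: parent_rel_def)
  then show ?thesis using assms by (auto simp: desc_def intro: converse_rtrancl_into_rtrancl)
qed

text \<open>A parent chain starting in \<open>A\<close> never leaves \<open>A\<close>. This serves
  both for the finished part of the goal tree and for the complement of a descendant set.\<close>

lemma desc_disjoint:
  assumes "A \<subseteq> verts G" "y \<notin> A" "\<And>v. v \<in> A \<Longrightarrow> v \<noteq> r \<Longrightarrow> snd (f v) \<in> A"
  shows "A \<inter> desc f y = {}"
  using assms rtrancl_closed[of _ y "parent_rel f" A]
  by (fastforce simp: desc_def parent_rel_def)

text \<open>Depth drops along parent chains, so \<open>y\<close> has smaller depth than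
  \<open>u\<close> and cannot descend from it.\<close>

lemma desc_psubset:
  assumes "rooted f" "u \<in> desc f y" "u \<noteq> y"
  shows "desc f u \<subset> desc f y"
proof -
  obtain d :: "'a \<Rightarrow> nat" where d: "\<And>v. v \<in> verts G - {r} \<Longrightarrow> d (snd (f v)) < d v"
    using assms(1) by (auto simp: rooted_def)
  have le: "d b \<le> d a" if "(a, b) \<in> (parent_rel f)\<^sup>*" for a b
    using that
  proof (induction rule: rtrancl_induct)
    case (step b c)
    then show ?case using d[of b] by (auto simp: parent_rel_def)
  qed simp
  have "d (snd (f u)) < d u" "d y \<le> d (snd (f u))"
    using parent_in_desc[OF assms(2,3,1)] d le assms(2) by (auto simp: desc_def)
  then have "y \<notin> desc f u" using le[of y u] by (auto simp: desc_def)
  moreover have "y \<in> verts G"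
  proof (rule rtrancl_closed)
    show "(u, y) \<in> (parent_rel f)\<^sup>*" "u \<in> verts G" using assms(2) by (auto simp: desc_def)
  qed (use rooted_edge(3)[OF assms(1)] in \<open>auto simp: parent_rel_def\<close>)
  then have "y \<in> desc f y" by (rule desc_self)
  moreover have "desc f u \<subseteq> desc f y" using assms(2) by (auto simp: desc_def)
  ultimately show ?thesis by blast
qed

text \<open>The complement of \<open>desc f y\<close> is closed under parents in \<open>f\<close>,
  and the moves do not touch it, so it is closed under parents in \<open>g\<close> as well.\<close>

lemma moves_desc_subset:
  assumes "moves D f g" "D \<subseteq> desc f y" "rooted f" "y \<in> verts G"
  shows "desc g y \<subseteq> desc f y"
proof -
  have "(verts G - desc f y) \<inter> desc g y = {}"
  proof (rule desc_disjoint)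
    fix v assume v: "v \<in> verts G - desc f y" "v \<noteq> r"
    then have "g v = f v" using moves_unchanged[OF assms(1)] assms(2) by blast
    then show "snd (g v) \<in> verts G - desc f y"
      using v rooted_edge(3)[OF assms(3)] in_desc_of_parent by auto
  qed (use assms(4) desc_self in auto)
  then show ?thesis by (auto simp: desc_def)
qed

section \<open>Making a vertex a leaf and building the goal tree\<close>

text \<open>Without \<open>y\<close> there is still a walk from \<open>z\<close> to the root, which
  is no descendant of \<open>y\<close>. An edge where this walk leaves \<open>desc f y\<close>
  avoids \<open>y\<close>.\<close>

lemma edge_leaving_desc:
  assumes "two_connected G" "y \<in> verts G - {r}" "z \<in> desc f y" "z \<noteq> y"
  shows "\<exists>u w e. u \<in> desc f y \<and> u \<noteq> y \<and> w \<notin> desc f y \<and> e \<in> edges G \<and> ends G e = {u, w}"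
proof -
  have "z \<in> verts (del_vertex G y)" "r \<in> verts (del_vertex G y)"
    using assms root by (auto simp: desc_def del_vertex_def)
  then have "(z, r) \<in> (adj (del_vertex G y))\<^sup>*"
    using assms(1,2) by (auto simp: two_connected_def cut_vertex_def reachable_adj)
  from rtrancl_leaves_set[OF this assms(3)] show ?thesis
    using root_notin_desc[of y f] assms(2) by (fastforce simp: adj_def del_vertex_def)
qed

text \<open>The induction hypothesis is used twice: for \<open>u\<close> below \<open>y\<close>, and
  again for \<open>y\<close> once \<open>u\<close> hangs elsewhere. Moving only proper descendants
  of \<open>y\<close> is what keeps the finished part of the goal tree intact later.\<close>

lemma moves_to_leaf:
  assumes "two_connected G" "rooted f" "y \<in> verts G - {r}"
  shows "\<exists>g. moves (desc f y - {y}) f g \<and> is_leaf g y"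
  using assms(2,3)
proof (induction "card (desc f y)" arbitrary: f y rule: less_induct)
  case less
  have fin: "finite (desc f z)" for f z using finite_verts by (simp add: desc_def)
  show ?case
  proof (cases "desc f y \<subseteq> {y}")
    case True
    have "is_leaf f y"
      unfolding is_leaf_def
    proof (intro conjI ballI notI)
      fix v assume v: "v \<in> verts G - {r}" "snd (f v) = y"
      then have "v \<in> desc f y" using in_desc_of_parent[of v f y] desc_self[of y f] less.prems(2) by auto
      then show False using True v rooted_edge(4)[OF less.prems(1), of v] by auto
    qed (use less.prems in auto)
    then show ?thesis using moves.refl by blast
  next
    case False
    then obtain u w e where u: "u \<in> desc f y" "u \<noteq> y" "w \<notin> desc f y" "e \<in> edges G"
      "ends G e = {u, w}"
      using edge_leaving_desc[OF assms(1) less.prems(2)] by blast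
    have sub: "desc f u \<subset> desc f y" by (rule desc_psubset[OF less.prems(1) u(1,2)])
    have uV: "u \<in> verts G - {r}"
      using u(1) root_notin_desc[of y f] less.prems(2) by (auto simp: desc_def)
    have "card (desc f u) < card (desc f y)" by (rule psubset_card_mono[OF fin sub])
    from less.hyps[OF this less.prems(1) uV] obtain g1
      where g1: "moves (desc f u - {u}) f g1" "is_leaf g1 u" by blast
    have yu: "y \<notin> desc f u"
      using desc_psubset[OF less.prems(1), of y u] sub u(2) by blast
    define g2 where "g2 = g1(u := (e, w))"
    have "moves (desc f y - {y}) f g1"
      using g1(1) sub yu by (auto intro: moves_mono)
    then have m2: "moves (desc f y - {y}) f g2"
      unfolding g2_def using g1(2) u by (intro moves.step) auto
    have r2: "rooted g2" by (rule moves_rooted[OF m2 less.prems(1)])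
    have sub2: "desc g2 y \<subseteq> desc f y"
      by (rule moves_desc_subset[OF m2]) (use less.prems in auto)
    \<comment> \<open>The new parent \<open>w\<close> of \<open>u\<close> lies outside
      \<open>desc f y\<close>, hence outside the smaller set \<open>desc g2 y\<close>, so
      \<open>u\<close> has been lost.\<close>
    have "u \<notin> desc g2 y"
      using parent_in_desc(2)[OF _ u(2) r2] sub2 u(3) by (auto simp: g2_def)
    then have "card (desc g2 y) < card (desc f y)"
      using sub2 u(1) by (intro psubset_card_mono[OF fin]) auto
    from less.hyps[OF this r2 less.prems(2)] obtain g
      where g: "moves (desc g2 y - {y}) g2 g" "is_leaf g y" by blast
    have "moves (desc f y - {y}) g2 g" using g(1) sub2 by (auto intro: moves_mono)
    then show ?thesis using moves_trans[OF _ m2] g(2) by blast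
  qed
qed

text \<open>\<open>S\<close> is the finished part: a subtree of the goal tree through the root on
  which \<open>f\<close> already has the goal's parents. The induction is on the number of vertices
  outside it.\<close>

lemma moves_to_goal:
  assumes "two_connected G" "rooted h"
    and "rooted f" "S \<subseteq> verts G" "r \<in> S" "\<And>v. v \<in> S \<Longrightarrow> v \<noteq> r \<Longrightarrow> f v = h v \<and> snd (h v) \<in> S"
  shows "\<exists>g. moves (verts G) f g \<and> (\<forall>v\<in>verts G - {r}. g v = h v)"
  using assms(3-)
proof (induction "card (verts G - S)" arbitrary: f S rule: less_induct)
  case less
  show ?case
  proof (cases "S = verts G")
    case True
    then show ?thesis using less.prems moves.refl by blast
  next
    case False
    obtain d :: "'a \<Rightarrow> nat" where d: "\<And>v. v \<in> verts G - {r} \<Longrightarrow> d (snd (h v)) < d v"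
      using assms(2) by (auto simp: rooted_def)
    obtain z where "z \<in> verts G - S" using False less.prems by blast
    \<comment> \<open>A vertex of least goal depth outside \<open>S\<close> has its goal parent in
      \<open>S\<close>.\<close>
    from arg_min_natI[where m = d and P = "\<lambda>v. v \<in> verts G - S", OF this]
      arg_min_nat_le[where m = d and P = "\<lambda>v. v \<in> verts G - S"]
    obtain y where y: "y \<in> verts G - S" "\<And>v. v \<in> verts G - S \<Longrightarrow> d y \<le> d v" by blast
    have yV: "y \<in> verts G" "y \<noteq> r" using y less.prems by auto
    note hy = rooted_edge[OF assms(2) yV]
    have hS: "snd (h y) \<in> S" using d[of y] y(2)[of "snd (h y)"] hy(3) yV by fastforce
    obtain g1 where g1: "moves (desc f y - {y}) f g1" "is_leaf g1 y"
      using moves_to_leaf[OF assms(1) less.prems(1), of y] yV by blast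
    have m1: "moves (verts G) f g1" using g1(1) by (rule moves_mono) (auto simp: desc_def)
    define g2 where "g2 = g1(y := h y)"
    have m2: "moves (verts G) f g2"
      using moves.step[OF m1 yV(1) g1(2) hy(1,2)] by (simp add: g2_def)
    have "S \<inter> desc f y = {}"
      using less.prems y by (intro desc_disjoint) auto
    then have "g1 v = f v" if "v \<in> S" for v
      using that moves_unchanged[OF g1(1)] by blast
    then have "g2 v = h v \<and> snd (h v) \<in> insert y S" if "v \<in> insert y S" "v \<noteq> r" for v
      using that less.prems(4) hS by (auto simp: g2_def)
    moreover have "card (verts G - insert y S) < card (verts G - S)"
      using y finite_verts by (intro psubset_card_mono) auto
    ultimately obtain g where "moves (verts G) g2 g" "\<forall>v\<in>verts G - {r}. g v = h v"
      using less.hyps[of "insert y S" g2] less.prems yV moves_rooted[OF m2] by blast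
    then show ?thesis using moves_trans[OF _ m2] by blast
  qed
qed

section \<open>Parent functions and spanning trees\<close>

lemma reachable_root:
  assumes "rooted f" "v \<in> verts G"
  shows "(v, r) \<in> (adj (G\<lparr>edges := tree_edges f\<rparr>))\<^sup>*"
proof -
  obtain d :: "'a \<Rightarrow> nat" where d: "\<And>v. v \<in> verts G - {r} \<Longrightarrow> d (snd (f v)) < d v"
    using assms(1) by (auto simp: rooted_def)
  show ?thesis
    using assms(2)
  proof (induction "d v" arbitrary: v rule: less_induct)
    case less
    show ?case
    proof (cases "v = r")
      case False
      note e = rooted_edge[OF assms(1) less.prems False]
      have "(v, snd (f v)) \<in> adj (G\<lparr>edges := tree_edges f\<rparr>)"
        using e less.prems False by (auto simp: adj_def tree_edges_def)
      then show ?thesis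
        using less.hyps[OF d e(3)] less.prems False
        by (auto intro: converse_rtrancl_into_rtrancl)
    qed simp
  qed
qed

lemma reachable_tree_edges:
  assumes "rooted f" "u \<in> verts G" "v \<in> verts G"
  shows "(u, v) \<in> (adj (G\<lparr>edges := tree_edges f\<rparr>))\<^sup>*"
  by (rule rtrancl_trans[OF reachable_root[OF assms(1,2)]
        symD[OF sym_rtrancl[OF sym_adj] reachable_root[OF assms(1,3)]]])

lemma tree_edges_spanning:
  assumes "rooted f"
  shows "tree_edges f \<in> spanning_trees G"
proof -
  let ?H = "G\<lparr>edges := tree_edges f\<rparr>"
  obtain d :: "'a \<Rightarrow> nat" where d: "\<And>v. v \<in> verts G - {r} \<Longrightarrow> d (snd (f v)) < d v"
    using assms(1) by (auto simp: rooted_def)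
  have sub: "tree_edges f \<subseteq> edges G" using rooted_edge(1)[OF assms] by (auto simp: tree_edges_def)
  have "connected ?H"
    using reachable_tree_edges[OF assms] root by (auto simp: connected_def reachable_adj)
  moreover have False if c: "is_cycle ?H vs es" for vs es
  proof -
    let ?n = "length vs"
    have n: "?n > 0" "length es = ?n" "distinct vs" "distinct es" "set vs \<subseteq> verts G"
      and es: "set es \<subseteq> tree_edges f"
      and en: "\<And>i. i < ?n \<Longrightarrow> ends G (es ! i) = {vs ! i, vs ! (Suc i mod ?n)}"
      using c by (auto simp: is_cycle_def)
    text \<open>At a vertex of maximal depth, both incident cycle edges have to be its parent edge.\<close>
    have "Max (d ` set vs) \<in> d ` set vs" using n by (intro Max_in) auto
    then obtain x where x: "x \<in> set vs" "d x = Max (d ` set vs)" by force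
    have mx: "d v \<le> d x" if "v \<in> set vs" for v using that x(2) by simp
    have par: "e = fst (f x)" if e: "e \<in> tree_edges f" "ends G e = {x, v}" "v \<in> set vs" for e v
    proof -
      obtain z where z: "z \<in> verts G" "z \<noteq> r" "e = fst (f z)" using e by (auto simp: tree_edges_def)
      \<comment> \<open>If \<open>v\<close> were the child and \<open>x\<close> its parent,
        \<open>v\<close> would be deeper than \<open>x\<close>.\<close>
      have "z \<noteq> v \<or> snd (f z) \<noteq> x" using d[of z] z mx[OF e(3)] by auto
      then have "z = x"
        using rooted_edge(2)[OF assms z(1,2)] z(3) e(2) by (auto simp: doubleton_eq_iff)
      then show ?thesis using z by simp
    qed
    obtain j where j: "j < ?n" "vs ! j = x" using x by (auto simp: in_set_conv_nth)
    \<comment> \<open>The cyclic predecessor of \<open>j\<close>: the cycle edges at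
      \<open>x\<close> are \<open>es ! i\<close> and \<open>es ! j\<close>.\<close>
    define i where "i = (if j = 0 then ?n - 1 else j - 1)"
    have i: "i < ?n" "Suc i mod ?n = j" using j n by (auto simp: i_def)
    have "es ! j = fst (f x)"
      using j n es en[OF j(1)] by (intro par[of _ "vs ! (Suc j mod ?n)"]) auto
    moreover have "es ! i = fst (f x)"
      using i j n es en[OF i(1)] by (intro par[of _ "vs ! i"]) auto
    \<comment> \<open>Distinctness of \<open>es\<close> leaves only a cycle of length one, a loop at
      \<open>x\<close>.\<close>
    ultimately have "i = j" using n i j by (metis nth_eq_iff_index_eq)
    then have "ends G (es ! j) = {x}" using en[OF j(1)] i j by simp
    moreover have "es ! j \<in> set es" using j n by simp
    then have "es ! j \<in> edges G" using es sub by blast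
    ultimately show False using card_ends by fastforce
  qed
  ultimately show ?thesis using sub by (auto simp: spanning_trees_def tree_def)
qed

text \<open>The parent of \<open>v\<close> is its predecessor on a shortest walk from the root in
  \<open>T\<close>. The parent edges already connect all vertices, so a further edge of
  \<open>T\<close> would close a cycle.\<close>

lemma spanning_tree_rooted:
  assumes "T \<in> spanning_trees G"
  shows "\<exists>f. rooted f \<and> tree_edges f = T"
proof -
  let ?H = "G\<lparr>edges := T\<rparr>"
  have T: "T \<subseteq> edges G" "connected ?H" "\<And>vs es. \<not> is_cycle ?H vs es"
    using assms by (auto simp: spanning_trees_def tree_def)
  define d where "d v = (LEAST n. (r, v) \<in> adj ?H ^^ n)" for v
  have "\<exists>p. fst p \<in> T \<and> ends G (fst p) = {v, snd p} \<and> d (snd p) < d v"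
    if v: "v \<in> verts G - {r}" for v
  proof -
    have "(r, v) \<in> (adj ?H)\<^sup>*" using T(2) v root by (auto simp: connected_def reachable_adj)
    then have dv: "(r, v) \<in> adj ?H ^^ d v"
      unfolding d_def by (metis rtrancl_imp_relpow LeastI)
    with v obtain m where m: "d v = Suc m" by (cases "d v") auto
    then obtain w where w: "(r, w) \<in> adj ?H ^^ m" "(w, v) \<in> adj ?H" using dv by auto
    have "d w \<le> m" unfolding d_def using w(1) by (rule Least_le)
    moreover obtain e where "e \<in> T" "ends G e = {w, v}" using w(2) by (auto simp: adj_def)
    ultimately show ?thesis using m by (intro exI[of _ "(e, w)"]) auto
  qed
  then obtain f where f: "\<And>v. v \<in> verts G - {r} \<Longrightarrow>
      fst (f v) \<in> T \<and> ends G (fst (f v)) = {v, snd (f v)} \<and> d (snd (f v)) < d v"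
    by metis
  then have rf: "rooted f" using T(1) by (auto simp: rooted_def)
  have sub: "tree_edges f \<subseteq> T" using f by (auto simp: tree_edges_def)
  have "e \<in> tree_edges f" if e: "e \<in> T" for e
  proof (rule ccontr)
    assume n: "e \<notin> tree_edges f"
    obtain a b where ab: "ends G e = {a, b}"
      using card_ends T(1) e by (meson card_2_iff subsetD)
    then have "(a, b) \<in> (adj (G\<lparr>edges := tree_edges f\<rparr>))\<^sup>*"
      using ends_subset[of e] T(1) e by (intro reachable_tree_edges[OF rf]) auto
    from cycle_of_chord[OF sub _ ab _ this] show False
      using T e n ends_subset by (meson DiffI subsetD)
  qed
  then show ?thesis using rf sub by blast
qed

section \<open>From leaf moves to exchanges\<close>

text \<open>A childless \<open>y\<close> meets no tree edge but its parent edge, which is thus a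
  leaf edge. The closure in the conclusion covers the case that \<open>e\<close> is the old parent
  edge.\<close>

lemma exchange_reattach:
  assumes "rooted f" "is_leaf f y" "e \<in> edges G" "ends G e = {y, w}"
  shows "(tree_edges f, tree_edges (f(y := (e, w)))) \<in> (exchange G)\<^sup>*"
proof (cases "e = fst (f y)")
  case True
  then have "tree_edges (f(y := (e, w))) = tree_edges f" by (auto simp: tree_edges_def)
  then show ?thesis by simp
next
  case False
  let ?g = "f(y := (e, w))"
  define F where "F = (\<lambda>v. fst (f v)) ` (verts G - {r} - {y})"
  have yV: "y \<in> verts G" "y \<noteq> r" using assms(2) by (auto simp: is_leaf_def)
  have y_F: "y \<notin> ends G e'" if "e' \<in> F" for e'
    using that rooted_edge(2)[OF assms(1)] assms(2) by (auto simp: F_def is_leaf_def)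
  note fy = rooted_edge[OF assms(1) yV]
  have Tf: "tree_edges f = insert (fst (f y)) F"
    using yV by (auto simp: tree_edges_def F_def)
  have "verts G - {r} = insert y (verts G - {r} - {y})" using yV by blast
  then have "tree_edges ?g = (\<lambda>v. fst (?g v)) ` insert y (verts G - {r} - {y})"
    unfolding tree_edges_def by (rule arg_cong)
  also have "\<dots> = insert e F"
    unfolding F_def image_insert by (intro arg_cong2[where f = insert] image_cong) auto
  finally have Tg: "tree_edges ?g = insert e F" .
  have nF: "fst (f y) \<notin> F" "e \<notin> F" using y_F fy(2) assms(4) by auto
  have diff: "tree_edges f - tree_edges ?g = {fst (f y)}" "tree_edges ?g - tree_edges f = {e}"
    using nF False unfolding Tf Tg by auto
  have "{e \<in> tree_edges f. y \<in> ends G e} = {fst (f y)}"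
    using y_F fy(2) by (auto simp: Tf)
  then have "leaf_edge G (tree_edges f) (fst (f y))"
    using yV fy(2) by (auto simp: leaf_edge_def leaf_vertex_def Tf)
  then have "(tree_edges f, tree_edges ?g) \<in> exchange G"
    using diff tree_edges_spanning[OF assms(1)] tree_edges_spanning[OF rooted_reattach[OF assms]]
    by (simp add: exchange_def)
  then show ?thesis by blast
qed

lemma moves_exchange:
  assumes "moves D f g" "rooted f"
  shows "(tree_edges f, tree_edges g) \<in> (exchange G)\<^sup>*"
  using assms
proof (induction rule: moves.induct)
  case (step g y e w)
  then show ?case using exchange_reattach moves_rooted by (meson rtrancl_trans)
qed simp

lemma exchange_connected:
  assumes "two_connected G" "T \<in> spanning_trees G" "T' \<in> spanning_trees G"
  shows "(T, T') \<in> (exchange G)\<^sup>*"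
proof -
  obtain f h where f: "rooted f" "tree_edges f = T" and h: "rooted h" "tree_edges h = T'"
    using spanning_tree_rooted assms(2,3) by meson
  obtain g where g: "moves (verts G) f g" "\<forall>v\<in>verts G - {r}. g v = h v"
    \<comment> \<open>Initially the finished part is the root alone.\<close>
    using moves_to_goal[OF assms(1) h(1) f(1), of "{r}"] root by auto
  have "tree_edges g = tree_edges h" using g(2) by (auto simp: tree_edges_def)
  then show ?thesis using moves_exchange[OF g(1) f(1)] f h by simp
qed

end

theorem corollary5p16:
  fixes G :: "('v, 'e) multigraph" and Tstart Tgoal :: "'e set"
  assumes "graph G" and "two_connected G"
    and "Tstart \<in> spanning_trees G" and "Tgoal \<in> spanning_trees G"
  shows "\<exists>(k::nat) (T :: nat \<Rightarrow> 'e set).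
           T 0 = Tstart \<and> T k = Tgoal \<and>
           (\<forall>i\<in>{0..k}. T i \<in> spanning_trees G) \<and>
           (\<forall>i\<in>{1..k}. card (T (i - 1) - T i) = 1 \<and> card (T i - T (i - 1)) = 1 \<and>
              (\<forall>e\<in>T (i - 1) - T i. leaf_edge G (T (i - 1)) e))"
proof -
  interpret graph G by fact
  obtain r where "r \<in> verts G" using connected by (auto simp: connected_def)
  then interpret rooted_graph G r by unfold_locales
  obtain k where "(Tstart, Tgoal) \<in> exchange G ^^ k"
    using exchange_connected[OF assms(2-4)] rtrancl_imp_relpow by blast
  then obtain T where T: "T 0 = Tstart" "T k = Tgoal" "\<And>i. i < k \<Longrightarrow> (T i, T (Suc i)) \<in> exchange G"
    unfolding relpow_fun_conv by blast
  have "T i \<in> spanning_trees G" if "i \<in> {0..k}" for i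
    \<comment> \<open>No exchange starts at \<open>T k\<close>, so the last tree is handled by
      \<open>T k = Tgoal\<close>; this includes \<open>k = 0\<close>.\<close>
    using that T assms(4) by (cases "i = k") (auto simp: exchange_def)
  moreover have "(T (i - 1), T i) \<in> exchange G" if "i \<in> {1..k}" for i
    using that T(3)[of "i - 1"] by auto
  ultimately show ?thesis using T(1,2) unfolding exchange_def by blast
qed

end
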